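(* Let $0<\alpha<2$ and $1<p<\infty$. Assume that $u\in L_\alpha\cap C^{1,1}_{loc}(\mathbb{R}^n)$ is a positive solution of $$(-\Delta)^{\alpha/2}u+u=u^p,\qquad x\in\mathbb{R}^n .$$ If $$\lim_{|x|\to\infty}u(x)=a<\left(\frac1p\right)^{\frac1{p-1}},$$ then $u$ must be radially symmetric and monotone decreasing about some point in $\mathbb{R}^n$; that is, there are $x_0\in\mathbb{R}^n$ and a monotone decreasing function $\varphi$ on $[0,\infty)$ with $u(x)=\varphi(|x-x_0|)$ for all $x\in\mathbb{R}^n$.
   Context: $L_\alpha=\{u:\mathbb{R}^n\to\mathbb{R} : \int_{\mathbb{R}^n}\frac{|u(x)|}{1+|x|^{n+\alpha}}\,dx<\infty\}$. $C^{1,1}_{loc}(\mathbb{R}^n)$ denotes differentiable functions with locally Lipschitz gradient. For $0<\alpha<2$ and $u\in L_\alpha\cap C^{1,1}_{loc}$, the fractional Laplacian is defined pointwise by $$(-\Delta)^{\alpha/2}u(x)=C_{n,\alpha}\lim_{\epsilon\to0}\int_{\mathbb{R}^n\setminus B_\epsilon(x)}\frac{u(x)-u(z)}{|x-z|^{n+\alpha}}\,dz,$$ where $C_{n,\alpha}>0$ is a normalization constant. *)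

theory Defs
  imports "HOL-Analysis.Analysis"
begin

text \<open>The measurability of \<open>u\<close> is implicit in the finiteness of the integral; it is
  stated separately because integrability of \<open>\<bar>u\<bar>\<close> alone would not give it.\<close>

definition L_space :: "real \<Rightarrow> (real ^ 'n \<Rightarrow> real) set" where
  "L_space \<alpha> = {u \<in> borel_measurable lebesgue.
     integrable lebesgue (\<lambda>x. \<bar>u x\<bar> / (1 + norm x powr (real CARD('n) + \<alpha>)))}"

definition C11_loc :: "(real ^ 'n \<Rightarrow> real) set" where
  "C11_loc = {u. \<exists>g. (\<forall>x. GDERIV u x :> g x) \<and>
     (\<forall>x. \<exists>r>0. \<exists>L. L-lipschitz_on (ball x r) g)}"

text \<open>The parameter \<open>C\<close> is the normalization constant. For \<open>0 < \<alpha> < 2\<close> and \<open>u\<close> in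
  \<^term>\<open>L_space \<alpha> \<inter> C11_loc\<close> the integrals converge absolutely and the limit exists;
  outside this class the value is not meaningful.\<close>

definition frac_laplacian :: "real \<Rightarrow> real \<Rightarrow> (real ^ 'n \<Rightarrow> real) \<Rightarrow> real ^ 'n \<Rightarrow> real" where
  "frac_laplacian C \<alpha> u x =
     C * Lim (at_right 0) (\<lambda>\<epsilon>. LINT z : - ball x \<epsilon> | lebesgue.
           (u x - u z) / norm (x - z) powr (real CARD('n) + \<alpha>))"

end

theory Submission
  imports Defs
begin

text \<open>The method of moving planes, applied directly to the singular integral. For a unit vector \<open>e\<close>
  let \<open>w\<close> be the difference between the reflection of \<open>u\<close> in the hyperplane \<open>x \<bullet> e = l\<close> and \<open>u\<close>.
  At a negative minimum \<open>x\<close> of \<open>w\<close> on the half space \<open>x \<bullet> e \<le> l\<close>, folding the integral along the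
  hyperplane shows that the fractional Laplacian of \<open>w\<close> is at most \<open>c w(x) / d\<^sup>\<alpha>\<close>, where \<open>d\<close> is the
  distance to the hyperplane, while the equation makes it at least \<open>(p u(x)\<^sup>p\<^sup>-\<^sup>1 - 1) w(x)\<close>. Hence
  \<open>p u(x)\<^sup>p\<^sup>-\<^sup>1 > 1\<close>, which the assumption on the limit \<open>a\<close> confines to a fixed ball, and \<open>d\<close> is bounded
  below by a fixed constant. So \<open>w \<ge> 0\<close> for \<open>l\<close> near \<open>-\<infinity>\<close>, and by compactness and the
  strong maximum principle the plane can be moved until \<open>w\<close> vanishes identically. Composing the
  reflections along a basis gives a centre of symmetry; if some symmetry hyperplane missed it, \<open>u\<close>
  would be periodic and therefore constant.\<close>

subsection \<open>Isometries and radial integrals\<close>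

lemma emeasure_open_le_isometry_image:
  fixes f :: "'a::euclidean_space \<Rightarrow> 'a"
  assumes "bij f" and iso: "\<And>x y. dist (f x) (f y) = dist x y" and "open U"
  shows "emeasure lborel U \<le> emeasure lborel (f ` U)"
proof -
  define K where "K = {(a, r). 0 < r \<and> ball a r \<subseteq> U}"
  have "\<exists>i. i \<in> K \<and> x \<in> ball (fst i) (snd i) \<and> snd i < d" if "x \<in> U" "0 < d" for x d
  proof -
    obtain e where "e > 0" "ball x e \<subseteq> U"
      using \<open>open U\<close> \<open>x \<in> U\<close> openE by blast
    then show ?thesis
      using \<open>0 < d\<close> by (intro exI[of _ "(x, min e d / 2)"]) (auto simp: K_def subset_iff)
  qed
  then obtain C where C: "countable C" "C \<subseteq> K"
     "pairwise (\<lambda>i j. disjnt (ball (fst i) (snd i)) (ball (fst j) (snd j))) C"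
     "negligible (U - (\<Union>i\<in>C. ball (fst i) (snd i)))"
    using Vitali_covering_theorem_balls[of U K fst snd] by blast
  let ?B = "\<lambda>i. ball (fst i) (snd i)"
  have img: "f ` ball a r = ball (f a) r" for a r
  proof
    show "ball (f a) r \<subseteq> f ` ball a r"
    proof
      fix y assume "y \<in> ball (f a) r"
      moreover obtain x where "y = f x" using \<open>bij f\<close> by (metis bij_pointE)
      ultimately show "y \<in> f ` ball a r" by (auto simp: iso)
    qed
  qed (auto simp: iso)
  have disj: "disjoint_family_on ?B C" "disjoint_family_on (\<lambda>i. f ` ?B i) C"
  proof -
    show 1: "disjoint_family_on ?B C"
      using C(3) by (auto simp: disjoint_family_on_def pairwise_def disjnt_def)
    have "inj f" using \<open>bij f\<close> by (simp add: bij_is_inj)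
    then have "f ` ?B m \<inter> f ` ?B n = f ` (?B m \<inter> ?B n)" for m n
      by (simp only: image_Int)
    with 1 show "disjoint_family_on (\<lambda>i. f ` ?B i) C"
      by (auto simp: disjoint_family_on_def)
  qed
  have "emeasure lborel U = emeasure lebesgue U"
    using \<open>open U\<close> by simp
  also have "\<dots> \<le> emeasure lebesgue ((\<Union>i\<in>C. ?B i) \<union> (U - (\<Union>i\<in>C. ?B i)))"
    using \<open>open U\<close> by (intro emeasure_mono sets_completionI_sets) (auto intro!: borel_open)
  also have "\<dots> = emeasure lebesgue (\<Union>i\<in>C. ?B i)"
    using C(1,4) by (intro emeasure_Un_null_set) (auto simp: negligible_iff_null_sets)
  also have "\<dots> = emeasure lborel (\<Union>i\<in>C. ?B i)"
  proof -
    have "open (\<Union>i\<in>C. ?B i)" by auto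
    then show ?thesis by simp
  qed
  also have "\<dots> = (\<integral>\<^sup>+i. emeasure lborel (?B i) \<partial>count_space C)"
    using C(1) disj by (intro emeasure_UN_countable) auto
  also have "\<dots> = (\<integral>\<^sup>+i. emeasure lborel (f ` ?B i) \<partial>count_space C)"
  proof (rule nn_integral_cong)
    fix i assume "i \<in> space (count_space C)"
    then have "snd i \<ge> 0" using C(2) by (auto simp: K_def)
    then show "emeasure lborel (?B i) = emeasure lborel (f ` ?B i)"
      by (simp add: img emeasure_ball)
  qed
  also have "\<dots> = emeasure lborel (\<Union>i\<in>C. f ` ?B i)"
    using C(1) disj by (intro emeasure_UN_countable[symmetric]) (auto simp: img)
  also have "\<dots> \<le> emeasure lborel (f ` U)"
  proof (rule emeasure_mono)
    have "f ` U = inv f -` U"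
      using \<open>bij f\<close> by (simp add: bij_vimage_eq_inv_image bij_imp_bij_inv inv_inv_eq)
    moreover have "continuous_on UNIV (inv f)"
    proof (rule continuous_on_iff[THEN iffD2], safe)
      fix x :: 'a and e :: real assume "0 < e"
      moreover have "dist (inv f y) (inv f x) = dist y x" for x y
        using iso[of "inv f y" "inv f x"] \<open>bij f\<close> by (simp add: bij_is_surj surj_f_inv_f)
      ultimately show "\<exists>d>0. \<forall>x'\<in>UNIV. dist x' x < d \<longrightarrow> dist (inv f x') (inv f x) < e"
        by auto
    qed
    ultimately have "open (f ` U)" using \<open>open U\<close> by (simp add: open_vimage)
    then show "f ` U \<in> sets lborel" by simp
  qed (use C(2) in \<open>force simp: K_def\<close>)
  finally show ?thesis .
qed

text \<open>An involution is its own inverse, so the preimage of a box is its image. The volume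
  inequality for open sets, applied to the box and then to its image, gives both directions, and the
  values on boxes determine Lebesgue measure.\<close>

lemma lborel_distr_isometric_involution:
  fixes f :: "'a::euclidean_space \<Rightarrow> 'a"
  assumes inv: "\<And>x. f (f x) = x" and iso: "\<And>x y. dist (f x) (f y) = dist x y"
  shows "f \<in> borel_measurable borel" "distr lborel borel f = lborel"
proof -
  have bij: "bij f" using inv by (metis bijI')
  have cont: "continuous_on UNIV f"
    unfolding continuous_on_iff using iso by auto
  then show m: "f \<in> borel_measurable borel" by (rule borel_measurable_continuous_onI)
  have vim: "f -` A = f ` A" for A
    using inv by (auto simp: image_iff) metis
  show "distr lborel borel f = lborel"
  proof (rule lborel_eqI[symmetric])
    fix l u :: 'a assume lu: "\<And>b. b \<in> Basis \<Longrightarrow> l \<bullet> b \<le> u \<bullet> b"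
    have "open (f ` box l u)"
      using open_vimage[OF open_box cont] by (simp add: vim)
    then have "emeasure lborel (f ` box l u) \<le> emeasure lborel (f ` f ` box l u)"
      using emeasure_open_le_isometry_image[OF bij iso] by blast
    moreover have "f ` f ` box l u = box l u" by (simp add: image_image inv)
    moreover have "emeasure lborel (box l u) \<le> emeasure lborel (f ` box l u)"
      by (intro emeasure_open_le_isometry_image[OF bij iso]) auto
    ultimately have "emeasure lborel (f ` box l u) = emeasure lborel (box l u)"
      by auto
    then show "emeasure (distr lborel borel f) (box l u) = ennreal (\<Prod>b\<in>Basis. (u - l) \<bullet> b)"
      using m lu by (simp add: emeasure_distr vim emeasure_lborel_box)
  qed simp
qed

lemma
  fixes T :: "'a::euclidean_space \<Rightarrow> 'a" and h :: "'a \<Rightarrow> real"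
  assumes "\<And>x. T (T x) = x" and "\<And>x y. dist (T x) (T y) = dist x y"
    and [measurable]: "h \<in> borel_measurable borel"
  shows integral_isometric_involution: "(\<integral>z. h (T z) \<partial>lborel) = (\<integral>z. h z \<partial>lborel)"
    and integrable_isometric_involution: "integrable lborel (\<lambda>z. h (T z)) \<longleftrightarrow> integrable lborel h"
proof -
  note T = lborel_distr_isometric_involution[of T, OF assms(1,2)]
  note [measurable] = T(1)
  show "(\<integral>z. h (T z) \<partial>lborel) = (\<integral>z. h z \<partial>lborel)"
    by (subst (2) T(2)[symmetric]) (simp add: integral_distr)
  show "integrable lborel (\<lambda>z. h (T z)) \<longleftrightarrow> integrable lborel h"
    by (subst (2) T(2)[symmetric]) (simp add: integrable_distr_eq)
qed

section \<open>Integrability of powers of the norm\<close>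

text \<open>The sum of the functions \<open>c k\<close> times the indicator of
  \<open>ball 0 (r k)\<close> dominates \<open>f\<close>. Integrated term by term, it gives the
  volume of the unit ball times the summable series.\<close>

lemma integrable_dyadic:
  fixes f :: "'a::euclidean_space \<Rightarrow> real"
  assumes [measurable]: "f \<in> borel_measurable borel" and nonneg: "\<And>y. 0 \<le> f y"
    and c: "\<And>k. 0 \<le> c k" and r: "\<And>k. 0 \<le> r k"
    and bound: "\<And>y. f y \<noteq> 0 \<Longrightarrow> \<exists>k::nat. y \<in> ball 0 (r k) \<and> f y \<le> c k"
    and summ: "summable (\<lambda>k. c k * r k ^ DIM('a))"
  shows "integrable lborel f"
proof (rule integrableI_nonneg)
  let ?V = "unit_ball_vol (real DIM('a))"
  have "(\<integral>\<^sup>+y. f y \<partial>lborel)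
      \<le> (\<integral>\<^sup>+y. (\<Sum>k. ennreal (c k) * indicator (ball 0 (r k)) (y::'a)) \<partial>lborel)"
  proof (intro nn_integral_mono)
    fix y :: 'a
    show "ennreal (f y) \<le> (\<Sum>k. ennreal (c k) * indicator (ball 0 (r k)) y)"
    proof (cases "f y = 0")
      case False
      then obtain k where k: "y \<in> ball 0 (r k)" "f y \<le> c k" using bound by blast
      then have "ennreal (f y) \<le> ennreal (c k) * indicator (ball 0 (r k)) y"
        by (simp add: ennreal_leI)
      also have "\<dots> \<le> (\<Sum>k. ennreal (c k) * indicator (ball 0 (r k)) y)"
      proof -
        define g where "g = (\<lambda>k. ennreal (c k) * indicator (ball 0 (r k)) y)"
        have "sum g {k} \<le> suminf g" by (intro sum_le_suminf) auto
        then have "g k \<le> suminf g" by simp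
        then show ?thesis by (simp only: g_def)
      qed
      finally show ?thesis .
    qed simp
  qed
  also have "\<dots> = (\<Sum>k. \<integral>\<^sup>+y. ennreal (c k) * indicator (ball 0 (r k)) (y::'a) \<partial>lborel)"
    by (intro nn_integral_suminf borel_measurable_times_ennreal borel_measurable_indicator) auto
  also have "\<dots> = (\<Sum>k. ennreal (?V * (c k * r k ^ DIM('a))))"
    using c r by (simp add: nn_integral_cmult_indicator emeasure_ball ennreal_mult'[symmetric] mult_ac)
  also have "\<dots> = ennreal (\<Sum>k. ?V * (c k * r k ^ DIM('a)))"
    using c r summ by (intro suminf_ennreal2 mult_nonneg_nonneg summable_mult) auto
  also have "\<dots> < \<infinity>" by simp
  finally show "(\<integral>\<^sup>+y. f y \<partial>lborel) < \<infinity>" .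
qed (use nonneg in auto)

text \<open>On the shell \<open>\<epsilon> * 2 ^ k \<le> norm y < \<epsilon> * 2 ^ Suc k\<close> the
  power is largest at the inner radius. The resulting series is geometric with ratio
  \<open>2 powr (DIM('a) - s)\<close>, which is less than 1.\<close>

lemma integrable_norm_powr_outside_ball:
  fixes s \<epsilon> :: real
  assumes s: "real DIM('a::euclidean_space) < s" and "0 < \<epsilon>"
  shows "integrable lborel (\<lambda>y::'a. indicator (- ball 0 \<epsilon>) y * norm y powr - s)"
proof (rule integrable_dyadic[where c = "\<lambda>k. (\<epsilon> * 2 ^ k) powr - s" and r = "\<lambda>k. \<epsilon> * 2 ^ Suc k"])
  fix y :: 'a assume "indicator (- ball 0 \<epsilon>) y * norm y powr - s \<noteq> 0"
  then have y: "\<epsilon> \<le> norm y" by (auto simp: indicator_def split: if_splits)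
  define k where "k = nat \<lfloor>log 2 (norm y / \<epsilon>)\<rfloor>"
  have q: "1 \<le> norm y / \<epsilon>" using y \<open>0 < \<epsilon>\<close> by simp
  then have "0 \<le> \<lfloor>log 2 (norm y / \<epsilon>)\<rfloor>" by simp
  then have "real k \<le> log 2 (norm y / \<epsilon>)" "log 2 (norm y / \<epsilon>) < real (Suc k)"
    by (auto simp: k_def) linarith
  with q have "2 ^ k \<le> norm y / \<epsilon>" "norm y / \<epsilon> < 2 ^ Suc k"
    by (auto simp: le_log_iff log_less_iff powr_realpow powr_add)
  then have "\<epsilon> * 2 ^ k \<le> norm y" "norm y < \<epsilon> * 2 ^ Suc k"
    using \<open>0 < \<epsilon>\<close> by (auto simp: field_simps)
  moreover from this have "norm y powr - s \<le> (\<epsilon> * 2 ^ k) powr - s"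
    using s \<open>0 < \<epsilon>\<close> by (intro powr_mono2') auto
  ultimately show "\<exists>k. y \<in> ball 0 (\<epsilon> * 2 ^ Suc k)
      \<and> indicator (- ball 0 \<epsilon>) y * norm y powr - s \<le> (\<epsilon> * 2 ^ k) powr - s"
    using y by (intro exI[of _ k]) auto
next
  have "(\<epsilon> * 2 ^ k) powr - s * (\<epsilon> * 2 ^ Suc k) ^ DIM('a)
      = (\<epsilon> powr - s * (2 * \<epsilon>) ^ DIM('a)) * (2 powr (real DIM('a) - s)) ^ k" for k
  proof -
    have "(2 ^ k) powr - s * (2 ^ k) ^ DIM('a) = (2 powr (real DIM('a) - s)) ^ k"
      by (simp add: powr_realpow[symmetric] powr_powr powr_add[symmetric] algebra_simps)
    then show ?thesis
      using \<open>0 < \<epsilon>\<close> by (simp add: powr_mult power_mult_distrib)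
  qed
  moreover have "summable (\<lambda>k. (2 powr (real DIM('a) - s)) ^ k)"
    using s by (intro summable_geometric) (simp add: powr_less_one)
  ultimately show "summable (\<lambda>k. (\<epsilon> * 2 ^ k) powr - s * (\<epsilon> * 2 ^ Suc k) ^ DIM('a))"
    by (simp add: summable_mult)
qed (use \<open>0 < \<epsilon>\<close> in auto)

text \<open>The shells are now \<open>(1/2) ^ Suc k < norm y \<le> (1/2) ^ k\<close>, and the ratio
  is \<open>2 powr (t - DIM('a))\<close>. The exponent may have either sign, so the variation of the
  power across a shell is absorbed in \<open>2 powr \<bar>t\<bar>\<close>; the radius is doubled
  because the outer sphere of a shell lies outside the open ball of radius
  \<open>(1/2) ^ k\<close>.\<close>

lemma integrable_norm_powr_unit_ball:
  fixes t :: real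
  assumes t: "t < real DIM('a::euclidean_space)"
  shows "integrable lborel (\<lambda>y::'a. indicator (ball 0 1) y * norm y powr - t)"
proof (rule integrable_dyadic[where c = "\<lambda>k. 2 powr \<bar>t\<bar> * (2 powr t) ^ k" and r = "\<lambda>k. 2 * (1/2) ^ k"])
  fix y :: 'a assume "indicator (ball 0 1) y * norm y powr - t \<noteq> 0"
  then have y: "norm y < 1" "0 < norm y" by (auto simp: indicator_def split: if_splits)
  define k where "k = nat \<lfloor>- log 2 (norm y)\<rfloor>"
  have "0 \<le> \<lfloor>- log 2 (norm y)\<rfloor>" using y by simp
  then have k: "real k \<le> - log 2 (norm y)" "- log 2 (norm y) < real k + 1"
    by (auto simp: k_def)
  have "norm y powr - t = 2 powr (- log 2 (norm y) * t)"
    using y by (simp add: powr_def log_def)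
  also have "\<dots> \<le> 2 powr (\<bar>t\<bar> + k * t)"
  proof -
    have "(- log 2 (norm y) - k) * t \<le> \<bar>(- log 2 (norm y) - k) * t\<bar>" by simp
    also have "\<dots> \<le> 1 * \<bar>t\<bar>"
      unfolding abs_mult using k by (intro mult_right_mono) auto
    finally show ?thesis by (simp add: algebra_simps)
  qed
  also have "\<dots> = 2 powr \<bar>t\<bar> * (2 powr t) ^ k"
    by (simp add: powr_add powr_realpow[symmetric] powr_powr mult_ac)
  finally have 1: "norm y powr - t \<le> 2 powr \<bar>t\<bar> * (2 powr t) ^ k" .
  have "norm y = 2 powr (log 2 (norm y))" using y by simp
  also have "\<dots> \<le> 2 powr (- real k)" using k by simp
  also have "\<dots> = (1/2) ^ k" by (simp add: powr_minus powr_realpow power_one_over inverse_eq_divide)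
  also have "\<dots> < 2 * (1/2) ^ k" by simp
  finally have "y \<in> ball 0 (2 * (1/2) ^ k)" by simp
  with 1 y show "\<exists>k. y \<in> ball 0 (2 * (1/2) ^ k)
      \<and> indicator (ball 0 1) y * norm y powr - t \<le> 2 powr \<bar>t\<bar> * (2 powr t) ^ k"
    by (intro exI[of _ k]) auto
next
  have "2 powr \<bar>t\<bar> * (2 powr t) ^ k * (2 * (1/2) ^ k) ^ DIM('a)
      = (2 powr \<bar>t\<bar> * 2 ^ DIM('a)) * (2 powr (t - real DIM('a))) ^ k" for k
  proof -
    have "(2 powr t) ^ k * ((1/2) ^ k) ^ DIM('a) = (2 powr (t - real DIM('a))) ^ k"
    proof -
      have "((1/2::real) ^ k) ^ DIM('a) = ((1/2) ^ DIM('a)) ^ k"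
        by (simp add: power_mult[symmetric] mult.commute)
      also have "(1/2::real) ^ DIM('a) = 2 powr - real DIM('a)"
        by (simp add: powr_minus_divide powr_realpow power_one_over)
      finally show ?thesis
        by (simp add: power_mult_distrib[symmetric] powr_add[symmetric])
    qed
    then show ?thesis by (simp add: power_mult_distrib)
  qed
  moreover have "summable (\<lambda>k. (2 powr (t - real DIM('a))) ^ k)"
    using t by (intro summable_geometric) (simp add: powr_less_one)
  ultimately show "summable (\<lambda>k. 2 powr \<bar>t\<bar> * (2 powr t) ^ k * (2 * (1/2) ^ k) ^ DIM('a))"
    by (simp only: summable_mult)
next
  show "(\<lambda>y::'a. indicator (ball 0 1) y * norm y powr - t) \<in> borel_measurable borel"
    by (intro borel_measurable_times borel_measurable_indicator) auto
qed auto

subsection \<open>Existence of the principal value\<close>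

text \<open>The integral of the principal value without its normalization constant, with
  \<open>s\<close> standing for the dimension plus \<alpha>, and over \<open>lborel\<close>, where
  the change of variables by an isometric involution is available.\<close>

definition truncated_integral :: "real \<Rightarrow> ('a::euclidean_space \<Rightarrow> real) \<Rightarrow> 'a \<Rightarrow> real \<Rightarrow> real" where
  "truncated_integral s u x \<epsilon> =
     (\<integral>z. indicator (- ball x \<epsilon>) z * ((u x - u z) / norm (x - z) powr s) \<partial>lborel)"

lemma borel_measurable_indicator_ball [measurable]:
  "(indicator (ball x r) :: 'a::euclidean_space \<Rightarrow> real) \<in> borel_measurable borel"
  "(indicator (- ball x r) :: 'a::euclidean_space \<Rightarrow> real) \<in> borel_measurable borel"
  by (auto intro!: borel_measurable_indicator)

text \<open>For Borel integrands the integral over the completion agrees with the one over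
  \<open>lborel\<close>. Since the limit exists, \<open>Lim\<close> returns it.\<close>

lemma frac_laplacian_eq:
  fixes u :: "real ^ 'n \<Rightarrow> real"
  assumes [measurable]: "u \<in> borel_measurable borel"
    and lim: "(truncated_integral (real CARD('n) + \<alpha>) u x \<longlongrightarrow> l) (at_right 0)"
  shows "frac_laplacian C \<alpha> u x = C * l"
proof -
  have "(LINT z : - ball x \<epsilon> | lebesgue. (u x - u z) / norm (x - z) powr (real CARD('n) + \<alpha>))
      = truncated_integral (real CARD('n) + \<alpha>) u x \<epsilon>" for \<epsilon>
    unfolding set_lebesgue_integral_def truncated_integral_def real_scaleR_def
    by (intro integral_completion) measurable
  then show ?thesis
    using lim by (simp add: frac_laplacian_def tendsto_Lim)
qed

text \<open>The kernel is moved to the origin by \<open>z \<mapsto> x - z\<close>, which unlike a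
  translation is an involution.\<close>

lemma integrable_kernel_outside_ball:
  fixes x :: "'a::euclidean_space"
  assumes "real DIM('a) < s" "0 < \<epsilon>"
  shows "integrable lborel (\<lambda>z. indicator (- ball x \<epsilon>) z * norm (x - z) powr - s)"
proof -
  have eq: "(\<lambda>z. indicator (- ball x \<epsilon>) z * norm (x - z) powr - s)
      = (\<lambda>z. (\<lambda>y. indicator (- ball 0 \<epsilon>) y * norm y powr - s) (x - z))"
    by (auto simp: indicator_def dist_norm norm_minus_commute)
  show ?thesis
    unfolding eq using integrable_norm_powr_outside_ball[OF assms]
    by (subst integrable_isometric_involution) (auto simp: dist_norm norm_minus_commute)
qed

lemma integrable_kernel_unit_ball:
  fixes x :: "'a::euclidean_space"
  assumes "t < real DIM('a)"
  shows "integrable lborel (\<lambda>z. indicator (ball x 1) z * norm (x - z) powr - t)"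
proof -
  have eq: "(\<lambda>z. indicator (ball x 1) z * norm (x - z) powr - t)
      = (\<lambda>z. (\<lambda>y. indicator (ball 0 1) y * norm y powr - t) (x - z))"
    by (auto simp: indicator_def dist_norm norm_minus_commute)
  show ?thesis
    unfolding eq using integrable_norm_powr_unit_ball[OF assms]
    by (subst integrable_isometric_involution) (auto simp: dist_norm norm_minus_commute)
qed

lemma integrable_truncated_integrand:
  fixes x :: "'a::euclidean_space"
  assumes [measurable]: "u \<in> borel_measurable borel" and bdd: "\<And>z. \<bar>u z\<bar> \<le> M"
    and "real DIM('a) < s" "0 < \<epsilon>"
  shows "integrable lborel (\<lambda>z. indicator (- ball x \<epsilon>) z * ((u x - u z) / norm (x - z) powr s))"
proof (rule Bochner_Integration.integrable_bound)
  show "integrable lborel (\<lambda>z. (2 * M) * (indicator (- ball x \<epsilon>) z * norm (x - z) powr - s))"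
    using integrable_kernel_outside_ball[OF assms(3,4)] by (intro integrable_mult_right)
  have "\<bar>u x - u z\<bar> \<le> 2 * \<bar>M\<bar>" for z
    using bdd[of x] bdd[of z] by linarith
  then show "AE z in lborel. norm (indicator (- ball x \<epsilon>) z * ((u x - u z) / norm (x - z) powr s))
      \<le> norm ((2 * M) * (indicator (- ball x \<epsilon>) z * norm (x - z) powr - s))"
    by (intro AE_I2) (auto simp: indicator_def powr_minus_divide abs_mult
        intro!: divide_right_mono intro: order_trans)
qed measurable

text \<open>The mean value theorem for \<open>\<phi> t = u (x + t y) + u (x - t y)\<close>: its
  derivative pairs \<open>y\<close> with the difference of the gradients at two points at distance
  at most \<open>2 * norm y\<close>, where the Lipschitz bound applies.\<close>

lemma second_difference_bound:
  fixes u :: "'a::euclidean_space \<Rightarrow> real"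
  assumes grad: "\<And>x. GDERIV u x :> g x" and lip: "L-lipschitz_on (ball x r) g" and "norm y < r"
  shows "\<bar>2 * u x - u (x + y) - u (x - y)\<bar> \<le> 2 * L * norm y ^ 2"
proof -
  define \<phi> where "\<phi> t = u (x + t *\<^sub>R y) + u (x - t *\<^sub>R y)" for t
  have "(\<phi> has_real_derivative (g (x + t *\<^sub>R y) - g (x - t *\<^sub>R y)) \<bullet> y) (at t)" for t
  proof -
    have plus: "((\<lambda>t. x + t *\<^sub>R y) has_derivative (\<lambda>h. h *\<^sub>R y)) (at t)"
      by (auto intro!: derivative_eq_intros)
    have minus: "((\<lambda>t. x - t *\<^sub>R y) has_derivative (\<lambda>h. - (h *\<^sub>R y))) (at t)"
      by (auto intro!: derivative_eq_intros)
    have "(\<phi> has_derivative (\<lambda>h. (h *\<^sub>R y) \<bullet> g (x + t *\<^sub>R y) + (- (h *\<^sub>R y)) \<bullet> g (x - t *\<^sub>R y))) (at t)"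
      unfolding \<phi>_def using has_derivative_compose[OF plus grad[unfolded gderiv_def]]
        has_derivative_compose[OF minus grad[unfolded gderiv_def]] by (rule has_derivative_add)
    then show ?thesis
      unfolding has_field_derivative_def
      by (rule has_derivative_eq_rhs) (auto simp: inner_diff_left inner_commute algebra_simps)
  qed
  then obtain t where t: "0 < t" "t < 1"
      and eq: "\<phi> 1 - \<phi> 0 = (1 - 0) * ((g (x + t *\<^sub>R y) - g (x - t *\<^sub>R y)) \<bullet> y)"
    using MVT2[of 0 1 \<phi> "\<lambda>t. (g (x + t *\<^sub>R y) - g (x - t *\<^sub>R y)) \<bullet> y"] by auto
  have ty: "norm (t *\<^sub>R y) \<le> norm y" using t by (simp add: mult_left_le_one_le)
  have L: "0 \<le> L" using lip by (rule lipschitz_on_nonneg)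
  have "dist (g (x + t *\<^sub>R y)) (g (x - t *\<^sub>R y)) \<le> L * dist (x + t *\<^sub>R y) (x - t *\<^sub>R y)"
    using ty \<open>norm y < r\<close> by (intro lipschitz_onD[OF lip]) (auto simp: dist_norm)
  also have "dist (x + t *\<^sub>R y) (x - t *\<^sub>R y) = norm (2 *\<^sub>R (t *\<^sub>R y))"
    by (simp only: dist_norm scaleR_2) (simp add: algebra_simps)
  also have "L * norm (2 *\<^sub>R (t *\<^sub>R y)) \<le> L * (2 * norm y)"
    using ty L by (intro mult_left_mono) auto
  finally have "norm (g (x + t *\<^sub>R y) - g (x - t *\<^sub>R y)) * norm y \<le> L * (2 * norm y) * norm y"
    by (intro mult_right_mono) (auto simp: dist_norm)
  then have "\<bar>\<phi> 1 - \<phi> 0\<bar> \<le> L * (2 * norm y) * norm y"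
    unfolding eq using Cauchy_Schwarz_ineq2[of "g (x + t *\<^sub>R y) - g (x - t *\<^sub>R y)" y] by simp
  then show ?thesis
    by (simp add: \<phi>_def power2_eq_square algebra_simps)
qed

text \<open>Averaging the truncated integrand over \<open>z \<mapsto> 2 x - z\<close> replaces the first difference of \<open>u\<close>
  by a second difference, which makes the singularity integrable.\<close>

lemma truncated_integral_converges:
  fixes u :: "'a::euclidean_space \<Rightarrow> real"
  assumes grad: "\<And>x. GDERIV u x :> g x" and lip: "L-lipschitz_on (ball x r) g" "0 < r"
    and bdd: "\<And>z. \<bar>u z\<bar> \<le> M" and \<alpha>: "0 < \<alpha>" "\<alpha> < 2"
  shows "\<exists>l. (truncated_integral (real DIM('a) + \<alpha>) u x \<longlongrightarrow> l) (at_right 0)"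
proof -
  define s where "s = real DIM('a) + \<alpha>"
  define T where "T z = 2 *\<^sub>R x - z" for z :: 'a
  define h where "h z = (2 * u x - u z - u (T z)) / norm (x - z) powr s" for z
  have "continuous_on UNIV u"
    using grad by (intro continuous_at_imp_continuous_on ballI)
      (metis has_derivative_continuous gderiv_def)
  then have [measurable]: "u \<in> borel_measurable borel"
    by (rule borel_measurable_continuous_onI)
  have [measurable]: "T \<in> borel_measurable borel" unfolding T_def by measurable
  have T: "T (T z) = z" "dist (T z) (T w) = dist z w" "norm (x - T z) = norm (x - z)"
      "T z \<in> ball x \<epsilon> \<longleftrightarrow> z \<in> ball x \<epsilon>" for z w \<epsilon>
    by (simp_all add: T_def dist_norm norm_minus_commute scaleR_2 algebra_simps)
  have s: "real DIM('a) < s" using \<alpha> by (simp add: s_def)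
  have M: "0 \<le> M" using bdd[of x] by linarith
  define \<rho> where "\<rho> = min r 1"
  have \<rho>: "0 < \<rho>" "\<rho> \<le> 1" "\<rho> \<le> r" using lip(2) by (auto simp: \<rho>_def)
  \<comment> \<open>Dominating function for the symmetrized integrand \<open>h\<close>. Near
    \<open>x\<close> the second difference leaves the exponent \<open>s - 2\<close>, which is below
    the dimension because \<alpha> < 2; away from \<open>x\<close> boundedness of \<open>u\<close>
    suffices.\<close>
  define D where "D z = 2 * L * (indicator (ball x 1) z * norm (x - z) powr - (s - 2))
      + 4 * M * (indicator (- ball x \<rho>) z * norm (x - z) powr - s)" for z
  have D: "integrable lborel D"
    unfolding D_def using integrable_kernel_unit_ball[of "s - 2" x] \<alpha> integrable_kernel_outside_ball[OF s \<rho>(1)]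
    by (intro Bochner_Integration.integrable_add integrable_mult_right) (auto simp: s_def)
  have L: "0 \<le> L" using lip(1) by (rule lipschitz_on_nonneg)
  have hD: "\<bar>h z\<bar> \<le> D z" for z
  proof (cases "z \<in> ball x \<rho>")
    case True
    have "\<bar>2 * u x - u (x + (z - x)) - u (x - (z - x))\<bar> \<le> 2 * L * norm (z - x) ^ 2"
      using True \<rho> by (intro second_difference_bound[OF grad lip(1)]) (auto simp: dist_norm norm_minus_commute)
    moreover have "x - (z - x) = T z" by (simp add: T_def scaleR_2)
    ultimately have "\<bar>h z\<bar> \<le> 2 * L * norm (x - z) ^ 2 / norm (x - z) powr s"
      by (simp add: h_def divide_right_mono norm_minus_commute)
    also have "\<dots> = 2 * L * norm (x - z) powr - (s - 2)"
      by (cases "z = x") (auto simp: powr_diff powr_numeral)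
    finally show ?thesis
      using True \<rho> M by (auto simp: D_def indicator_def)
  next
    case False
    have "\<bar>2 * u x - u z - u (T z)\<bar> \<le> 4 * M"
      using bdd[of x] bdd[of z] bdd[of "T z"] by linarith
    then have "\<bar>h z\<bar> \<le> 4 * M * norm (x - z) powr - s"
      by (simp add: h_def powr_minus_divide divide_right_mono)
    then show ?thesis
      using False L by (auto simp: D_def indicator_def add_increasing)
  qed
  have half: "truncated_integral s u x \<epsilon> = (\<integral>z. indicator (- ball x \<epsilon>) z * h z \<partial>lborel) / 2" if "0 < \<epsilon>" for \<epsilon>
  proof -
    define k where "k z = indicator (- ball x \<epsilon>) z * ((u x - u z) / norm (x - z) powr s)" for z
    have k: "integrable lborel k"
      unfolding k_def by (rule integrable_truncated_integrand[OF _ bdd s that]) measurable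
    have [measurable]: "k \<in> borel_measurable borel" unfolding k_def by measurable
    have kT: "integrable lborel (\<lambda>z. k (T z))" "(\<integral>z. k (T z) \<partial>lborel) = (\<integral>z. k z \<partial>lborel)"
      using k T by (auto simp: integrable_isometric_involution integral_isometric_involution)
    have "indicator (- ball x \<epsilon>) z * h z = k z + k (T z)" for z
      using T(3)[of z] T(4)[of z \<epsilon>]
      by (simp add: k_def h_def indicator_def add_divide_distrib[symmetric] del: mem_ball)
    then have "(\<integral>z. indicator (- ball x \<epsilon>) z * h z \<partial>lborel) = 2 * (\<integral>z. k z \<partial>lborel)"
      using k kT by simp
    then show ?thesis by (simp add: truncated_integral_def k_def)
  qed
  have "(truncated_integral s u x \<longlongrightarrow> (\<integral>z. h z \<partial>lborel) / 2) (at_right 0)"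
  proof (rule tendsto_at_right_sequentially[of 0 1])
    fix S :: "nat \<Rightarrow> real" assume S: "\<And>n. 0 < S n" "S \<longlonglongrightarrow> 0"
    have "(\<lambda>n. \<integral>z. indicator (- ball x (S n)) z * h z \<partial>lborel) \<longlonglongrightarrow> (\<integral>z. h z \<partial>lborel)"
    proof (rule integral_dominated_convergence[OF _ _ D])
      show "AE z in lborel. (\<lambda>n. indicator (- ball x (S n)) z * h z) \<longlonglongrightarrow> h z"
      proof (intro AE_I2)
        fix z show "(\<lambda>n. indicator (- ball x (S n)) z * h z) \<longlonglongrightarrow> h z"
        proof (cases "z = x")
          case False
          then have "eventually (\<lambda>n. S n < dist x z) sequentially"
            using S(2) by (intro order_tendstoD) auto
          then have "eventually (\<lambda>n. indicator (- ball x (S n)) z * h z = h z) sequentially"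
            by eventually_elim auto
          then show ?thesis by (rule tendsto_eventually)
        qed (simp add: h_def)
      qed
      show "AE z in lborel. norm (indicator (- ball x (S n)) z * h z) \<le> D z" for n
        using hD by (intro AE_I2) (auto simp: indicator_def intro: order_trans[OF _ hD])
    qed (simp_all add: h_def)
    then show "(\<lambda>n. truncated_integral s u x (S n)) \<longlonglongrightarrow> (\<integral>z. h z \<partial>lborel) / 2"
      using S(1) by (simp add: half tendsto_divide)
  qed simp
  then show ?thesis unfolding s_def by blast
qed

subsection \<open>Reflections\<close>

definition reflection :: "'a::euclidean_space \<Rightarrow> real \<Rightarrow> 'a \<Rightarrow> 'a" where
  "reflection e l z = z - (2 * (z \<bullet> e - l)) *\<^sub>R e"

lemma inner_reflection:
  assumes "norm e = 1" shows "reflection e l z \<bullet> e = 2 * l - z \<bullet> e"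
  using assms by (simp add: reflection_def inner_diff_left norm_eq_1)

lemma reflection_reflection:
  assumes "norm e = 1" shows "reflection e l (reflection e l z) = z"
  using inner_reflection[OF assms, of l z]
  by (subst reflection_def) (simp add: reflection_def algebra_simps flip: scaleR_left_distrib)

text \<open>The single computation behind the geometry of reflections: the sign of the product term
  decides whether a point or its mirror image is nearer to \<open>x\<close>, and the isometry
  property follows by using the identity twice.\<close>

lemma dist_reflection_squared:
  assumes "norm e = 1"
  shows "(dist x (reflection e l z))\<^sup>2 = (dist x z)\<^sup>2 + 4 * (l - x \<bullet> e) * (l - z \<bullet> e)"
proof -
  have "(dist x (reflection e l z))\<^sup>2 = (norm ((x - z) + (2 * (z \<bullet> e - l)) *\<^sub>R e))\<^sup>2"
    by (simp add: dist_norm reflection_def algebra_simps)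
  also have "\<dots> = (norm (x - z))\<^sup>2 + 2 * (2 * (z \<bullet> e - l)) * ((x - z) \<bullet> e) + (2 * (z \<bullet> e - l))\<^sup>2"
    using assms unfolding power2_norm_eq_inner
    by (simp add: inner_simps norm_eq_1 inner_commute power2_eq_square algebra_simps)
  finally show ?thesis
    by (simp add: dist_norm inner_diff_left power2_eq_square algebra_simps)
qed

lemma dist_reflection:
  assumes e: "norm e = 1"
  shows "dist (reflection e l x) (reflection e l y) = dist x y"
proof -
  have "(dist (reflection e l x) (reflection e l y))\<^sup>2
      = (dist y (reflection e l x))\<^sup>2 + 4 * (l - reflection e l x \<bullet> e) * (l - y \<bullet> e)"
    using dist_reflection_squared[OF e, of "reflection e l x" l y] by (simp add: dist_commute)
  also have "\<dots> = (dist y x)\<^sup>2"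
    by (simp add: dist_reflection_squared[OF e] inner_reflection[OF e] algebra_simps)
  finally show ?thesis by (simp add: dist_commute)
qed

lemma dist_le_dist_reflection:
  assumes "norm e = 1" "x \<bullet> e \<le> l" "z \<bullet> e \<le> l"
  shows "dist x z \<le> dist x (reflection e l z)"
proof -
  have "(dist x z)\<^sup>2 \<le> (dist x (reflection e l z))\<^sup>2"
    using assms by (simp add: dist_reflection_squared)
  then show ?thesis by (rule power2_le_imp_le) simp
qed

lemma dist_less_dist_reflection:
  assumes "norm e = 1" "x \<bullet> e < l" "z \<bullet> e < l"
  shows "dist x z < dist x (reflection e l z)"
proof -
  have "(dist x z)\<^sup>2 < (dist x (reflection e l z))\<^sup>2"
    using assms by (simp add: dist_reflection_squared)
  then show ?thesis by (rule power2_less_imp_less) simp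
qed

lemma inner_diff_le_dist:
  assumes "norm e = 1" shows "y \<bullet> e - x \<bullet> e \<le> dist x y"
  using Cauchy_Schwarz_ineq2[of "y - x" e] assms by (simp add: inner_diff_left dist_norm norm_minus_commute)

lemma continuous_reflection [continuous_intros]:
  "continuous_on A f \<Longrightarrow> continuous_on A g \<Longrightarrow> continuous_on A (\<lambda>x. reflection e (f x) (g x))"
  unfolding reflection_def by (intro continuous_intros)

lemma borel_measurable_reflection [measurable]: "reflection e l \<in> borel_measurable borel"
  by (intro borel_measurable_continuous_onI continuous_intros)

text \<open>Folding the integral over the two half spaces turns the kernel into
  \<open>(w z - w x) (K z - K z') - 2 w x K z'\<close> with \<open>z'\<close> the mirror image of \<open>z\<close>, which is
  nonnegative on the half space containing \<open>x\<close>; so it may be bounded below on a single ball.\<close>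

lemma reflected_difference_bound:
  fixes u w :: "'a::euclidean_space \<Rightarrow> real" and s :: real
  defines "K \<equiv> \<lambda>x z. dist x z powr - s"
  assumes e: "norm e = 1" and [measurable]: "u \<in> borel_measurable borel" and bdd: "\<And>z. \<bar>u z\<bar> \<le> M"
    and s: "real DIM('a) < s"
    and w: "\<And>z. w z = u (reflection e l z) - u z"
    and lim1: "(truncated_integral s u (reflection e l x) \<longlongrightarrow> l1) (at_right 0)"
    and lim0: "(truncated_integral s u x \<longlongrightarrow> l0) (at_right 0)"
    and x: "x \<bullet> e < l" "w x \<le> 0" and min: "\<And>z. z \<bullet> e \<le> l \<Longrightarrow> w x \<le> w z"
    and c: "\<And>z. z \<in> ball c r \<Longrightarrow> z \<bullet> e < l" "0 \<le> r" "r < dist c x" and \<eta>: "0 \<le> \<eta>"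
    and low: "\<And>z. z \<in> ball c r \<Longrightarrow> \<eta> \<le> (w z - w x) * (K x z - K x (reflection e l z))
                                 - 2 * w x * K x (reflection e l z)"
  shows "l1 - l0 \<le> - \<eta> * measure lborel (ball c r)"
proof -
  let ?R = "reflection e l"
  note RR = reflection_reflection[OF e, of l] and dR = dist_reflection[OF e, of l]
    and iR = inner_reflection[OF e, of l]
  have [measurable]: "w \<in> borel_measurable borel"
    using w by (subst measurable_cong[where g="\<lambda>z. u (?R z) - u z"]) auto
  define d where "d = l - x \<bullet> e"
  have d: "0 < d" using x by (simp add: d_def)
  \<comment> \<open>A mirror image is at distance at least \<open>d\<close> from \<open>x\<close>,
    and \<open>w x + w z\<close> is at most \<open>4 * M\<close>; hence \<open>B\<close> bounds its
    contribution.\<close>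
  define B where "B = 4 * M * d powr - s"
  have wbd: "\<bar>w z\<bar> \<le> 2 * M" for z
    using bdd[of z] bdd[of "?R z"] by (auto simp: w)
  have wR: "w (?R z) = - w z" for z by (simp add: w RR)
  have s0: "0 < s" using s by (rule le_less_trans[rotated]) simp
  have far: "d \<le> dist x z" if "l \<le> z \<bullet> e" for z
    using inner_diff_le_dist[OF e, of z x] that by (simp add: d_def)
  have bound: "truncated_integral s u (?R x) \<epsilon> - truncated_integral s u x \<epsilon>
      \<le> B * measure lborel (ball x \<epsilon>) - \<eta> * measure lborel (ball c r)"
    if \<epsilon>: "0 < \<epsilon>" "\<epsilon> < d" "\<epsilon> < dist c x - r" for \<epsilon>
  proof -
    define k where "k y z = indicator (- ball y \<epsilon>) z * ((u y - u z) / norm (y - z) powr s)" for y z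
    define f where "f z = indicator (- ball x \<epsilon>) z * ((w x - w z) * K x z)" for z
    \<comment> \<open>Comparison function after folding: the error \<open>B\<close> on the excluded
      ball, whose mirror image is not excluded, and the gain \<eta> on \<open>ball c r\<close>. The
      bounds on \<epsilon> keep the excluded ball disjoint from \<open>ball c r\<close> and on the
      side of \<open>x\<close>.\<close>
    define G where "G z = B * indicator (ball x \<epsilon>) z - \<eta> * indicator (ball c r) z" for z
    have [measurable]: "k y \<in> borel_measurable borel" for y unfolding k_def by measurable
    have [measurable]: "f \<in> borel_measurable borel" unfolding f_def K_def by measurable
    have [measurable]: "G \<in> borel_measurable borel" unfolding G_def by measurable
    have Gi: "integrable lborel G"
      unfolding G_def by (intro Bochner_Integration.integrable_diff integrable_mult_right
          integrable_real_indicator) (auto simp: emeasure_lborel_ball_finite[unfolded infinity_ennreal_def])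
    have k: "integrable lborel (k y)" for y
      unfolding k_def by (rule integrable_truncated_integrand[OF _ bdd s \<epsilon>(1)]) measurable
    have kR: "integrable lborel (\<lambda>z. k (?R x) (?R z))"
        "(\<integral>z. k (?R x) (?R z) \<partial>lborel) = (\<integral>z. k (?R x) z \<partial>lborel)"
      using k RR dR by (auto simp: integrable_isometric_involution integral_isometric_involution)
    have fk: "f z = k (?R x) (?R z) - k x z" for z
      using dR[of x z]
      by (auto simp: f_def k_def w K_def indicator_def powr_minus_divide diff_divide_distrib dist_norm)
    then have f: "integrable lborel f"
      using k kR(1) by (subst Bochner_Integration.integrable_cong[OF refl fk]) auto
    have "truncated_integral s u (?R x) \<epsilon> - truncated_integral s u x \<epsilon>
        = (\<integral>z. k (?R x) z \<partial>lborel) - (\<integral>z. k x z \<partial>lborel)"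
      by (simp add: truncated_integral_def k_def)
    also have "\<dots> = (\<integral>z. f z \<partial>lborel)"
      unfolding fk using k kR by (simp only: Bochner_Integration.integral_diff)
    \<comment> \<open>The reflection preserves integrals, so \<open>f\<close> may be symmetrized.
      Both symmetrized functions are invariant under the reflection, and it is enough to compare
      them on the half space containing \<open>x\<close>.\<close>
    also have "\<dots> = (\<integral>z. f z + f (?R z) \<partial>lborel) / 2"
      using f RR dR by (simp add: integrable_isometric_involution integral_isometric_involution)
    also have "\<dots> \<le> (\<integral>z. G z + G (?R z) \<partial>lborel) / 2"
    proof -
      have half: "f z + f (?R z) \<le> G z + G (?R z)" if z: "z \<bullet> e \<le> l" for z
      proof -
        have Rz: "d \<le> dist x (?R z)" using z by (intro far) (simp add: iR)
        have "?R z \<notin> ball x \<epsilon>" using Rz \<epsilon> by auto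
        moreover have "?R z \<notin> ball c r" using c(1)[of "?R z"] z iR[of z] by auto
        ultimately have GR: "G (?R z) = 0" and fR: "f (?R z) = (w x + w z) * K x (?R z)"
          by (simp_all add: G_def f_def wR del: mem_ball)
        show ?thesis
        proof (cases "z \<in> ball x \<epsilon>")
          case True
          have "dist c x \<le> dist c z + dist z x" by (rule dist_triangle)
          with True \<epsilon> have "z \<notin> ball c r" by (auto simp: dist_commute)
          then have Gz: "G z = B" and fz: "f z = 0" using True by (simp_all add: G_def f_def)
          have "(w x + w z) * K x (?R z) \<le> (4 * M) * K x (?R z)"
            using wbd[of x] wbd[of z] by (intro mult_right_mono) (auto simp: K_def)
          also have "\<dots> \<le> B"
            unfolding B_def K_def using Rz d s0 wbd[of x]
            by (intro mult_left_mono powr_mono2') auto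
          finally show ?thesis by (simp add: GR fR Gz fz)
        next
          case False
          then have "0 < dist x z" using \<epsilon> by auto
          have sum: "f z + f (?R z) = - ((w z - w x) * (K x z - K x (?R z)) - 2 * w x * K x (?R z))"
          proof -
            have "f z = (w x - w z) * K x z" using False by (simp add: f_def)
            then show ?thesis by (simp only: fR) (simp add: algebra_simps)
          qed
          have 1: "0 \<le> (w z - w x) * (K x z - K x (?R z))"
          proof (intro mult_nonneg_nonneg)
            show "0 \<le> K x z - K x (?R z)"
              using dist_le_dist_reflection[OF e _ z, of x] x s0 \<open>0 < dist x z\<close>
              by (simp add: K_def powr_mono2')
          qed (use min[OF z] in simp)
          have 2: "0 \<le> - 2 * w x * K x (?R z)"
            using mult_nonpos_nonneg[OF x(2), of "K x (?R z)"] by (simp add: K_def)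
          show ?thesis
          proof -
            have Gz: "G z = - \<eta> * indicator (ball c r) z" using False by (simp add: G_def)
            show ?thesis
            proof (cases "z \<in> ball c r")
              case True
              have "f z + f (?R z) \<le> - \<eta>"
                using sum low[OF True] by linarith
              then show ?thesis using True by (simp add: GR Gz)
            next
              case False
              then show ?thesis
                using sum 1 2 by (simp add: GR Gz)
            qed
          qed
        qed
      qed
      have "f z + f (?R z) \<le> G z + G (?R z)" for z
      proof (cases "z \<bullet> e \<le> l")
        case False
        then show ?thesis using half[of "?R z"] by (simp add: iR RR)
      qed (rule half)
      then show ?thesis
        using f Gi RR dR by (intro divide_right_mono integral_mono)
          (auto simp: integrable_isometric_involution)
    qed
    also have "\<dots> = (\<integral>z. G z \<partial>lborel)"
      using Gi RR dR by (simp add: integrable_isometric_involution integral_isometric_involution)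
    also have "\<dots> = B * measure lborel (ball x \<epsilon>) - \<eta> * measure lborel (ball c r)"
      unfolding G_def by (subst Bochner_Integration.integral_diff)
        (auto intro!: integrable_mult_right integrable_real_indicator simp: emeasure_lborel_ball_finite[unfolded infinity_ennreal_def])
    finally show ?thesis .
  qed
  \<comment> \<open>The error disappears in the limit together with the volume of the excluded
    ball.\<close>
  have "((\<lambda>\<epsilon>. B * measure lborel (ball x \<epsilon>) - \<eta> * measure lborel (ball c r))
      \<longlongrightarrow> B * 0 - \<eta> * measure lborel (ball c r)) (at_right 0)"
  proof (intro tendsto_intros)
    have "((\<lambda>\<epsilon>. unit_ball_vol DIM('a) * \<epsilon> ^ DIM('a)) \<longlongrightarrow> 0) (at_right 0)"
      by (rule tendsto_eq_intros refl | simp)+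
    moreover have "eventually (\<lambda>\<epsilon>. unit_ball_vol DIM('a) * \<epsilon> ^ DIM('a) = measure lborel (ball x \<epsilon>)) (at_right 0)"
      using eventually_at_right_less[of 0] by eventually_elim (simp add: content_ball)
    ultimately show "((\<lambda>\<epsilon>. measure lborel (ball x \<epsilon>)) \<longlongrightarrow> 0) (at_right 0)"
      by (rule Lim_transform_eventually)
  qed
  moreover have "eventually (\<lambda>\<epsilon>. truncated_integral s u (?R x) \<epsilon> - truncated_integral s u x \<epsilon>
      \<le> B * measure lborel (ball x \<epsilon>) - \<eta> * measure lborel (ball c r)) (at_right 0)"
  proof -
    have "eventually (\<lambda>\<epsilon>. \<epsilon> < min d (dist c x - r)) (at_right 0)"
      using d c by (intro order_tendstoD[where y=0] tendsto_intros) auto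
    then show ?thesis
      using eventually_at_right_less[of 0] by eventually_elim (intro bound, auto)
  qed
  moreover have "((\<lambda>\<epsilon>. truncated_integral s u (?R x) \<epsilon> - truncated_integral s u x \<epsilon>) \<longlongrightarrow> l1 - l0) (at_right 0)"
    by (intro tendsto_intros lim1 lim0)
  ultimately show ?thesis
    using tendsto_le[of "at_right (0::real)"] by fastforce
qed

subsection \<open>Moving planes\<close>

text \<open>Mean value theorem, with the increasing derivative evaluated at the larger endpoint
  \<open>y\<close>. In the application this endpoint is the value of \<open>u\<close> at the minimum
  of \<open>w\<close>, not at its mirror image.\<close>

lemma powr_diff_le:
  fixes p v y :: real
  assumes "1 < p" "0 < v" "v < y"
  shows "y powr p - v powr p \<le> p * y powr (p - 1) * (y - v)"
proof -
  have "\<exists>\<xi>. v < \<xi> \<and> \<xi> < y \<and> y powr p - v powr p = (y - v) * (p * \<xi> powr (p - 1))"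
    using assms by (intro MVT2) (auto intro!: derivative_eq_intros)
  then obtain \<xi> where \<xi>: "v < \<xi>" "\<xi> < y" "y powr p - v powr p = (y - v) * (p * \<xi> powr (p - 1))"
    by blast
  have "\<xi> powr (p - 1) \<le> y powr (p - 1)"
    using \<xi> assms by (intro powr_mono2) auto
  then have "(y - v) * (p * \<xi> powr (p - 1)) \<le> (y - v) * (p * y powr (p - 1))"
    using assms by (intro mult_left_mono) auto
  then show ?thesis by (simp add: \<xi>(3) mult_ac)
qed

lemma bounded_if_tendsto_at_infinity:
  fixes u :: "'a::euclidean_space \<Rightarrow> real"
  assumes cont: "continuous_on UNIV u" and lim: "(u \<longlongrightarrow> a) at_infinity"
  shows "\<exists>M. \<forall>x. \<bar>u x\<bar> \<le> M"
proof -
  obtain b where b: "\<And>x. b \<le> norm x \<Longrightarrow> dist (u x) a < 1"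
    using lim[unfolded Lim_at_infinity, rule_format, of 1] by auto
  have "compact (u ` cball 0 b)"
    using cont by (intro compact_continuous_image continuous_on_subset[OF cont]) auto
  then have "bounded (u ` cball 0 b)" by (rule compact_imp_bounded)
  then obtain B where "\<forall>y\<in>u ` cball 0 b. norm y \<le> B"
    unfolding bounded_iff by (rule exE)
  then have B: "\<bar>u x\<bar> \<le> B" if "x \<in> cball 0 b" for x using that by simp
  have "\<bar>u x\<bar> \<le> max B (\<bar>a\<bar> + 1)" for x
  proof (cases "b \<le> norm x")
    case True
    then show ?thesis using b[of x] by (auto simp: dist_real_def)
  next
    case False
    then show ?thesis using B[of x] by auto
  qed
  then show ?thesis by blast
qed

text \<open>The equation is stated as convergence of the truncated integrals, so that limits at a
  point and at its mirror image can be subtracted. The bound \<open>M\<close> enters the constants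
  of the estimates.\<close>

locale moving_planes =
  fixes u :: "'a::euclidean_space \<Rightarrow> real" and s p a C M :: real
  assumes s: "real DIM('a) < s" and p: "1 < p" and C: "0 < C"
    and cont: "continuous_on UNIV u" and pos: "\<And>x. 0 < u x" and bdd: "\<And>x. \<bar>u x\<bar> \<le> M"
    and equation: "\<And>x. \<exists>l. (truncated_integral s u x \<longlongrightarrow> l) (at_right 0) \<and> C * l + u x = u x powr p"
    and limit: "(u \<longlongrightarrow> a) at_infinity" and small: "a < (1 / p) powr (1 / (p - 1))"
begin

definition w :: "'a \<Rightarrow> real \<Rightarrow> 'a \<Rightarrow> real" where
  "w e l z = u (reflection e l z) - u z"

lemma w_reflection: "norm e = 1 \<Longrightarrow> w e l (reflection e l z) = - w e l z"
  by (simp add: w_def reflection_reflection)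

lemma w_hyperplane: "z \<bullet> e = l \<Longrightarrow> w e l z = 0"
  by (simp add: w_def reflection_def)

lemma continuous_on_u [continuous_intros]:
  "continuous_on A f \<Longrightarrow> continuous_on A (\<lambda>x. u (f x))"
  using continuous_on_compose2[OF cont] by auto

lemma continuous_on_w [continuous_intros]:
  "continuous_on A f \<Longrightarrow> continuous_on A g \<Longrightarrow> continuous_on A (\<lambda>x. w e (f x) (g x))"
  unfolding w_def by (intro continuous_intros)

lemma measurable_u: "u \<in> borel_measurable borel"
  using cont by (rule borel_measurable_continuous_onI)

section \<open>Positions of the plane and estimates at negative minima\<close>

definition admissible :: "'a \<Rightarrow> real \<Rightarrow> bool" where
  "admissible e l \<longleftrightarrow> (\<forall>z. z \<bullet> e \<le> l \<longrightarrow> 0 \<le> w e l z)"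

definition negative_min :: "'a \<Rightarrow> real \<Rightarrow> 'a \<Rightarrow> bool" where
  "negative_min e l x \<longleftrightarrow> x \<bullet> e < l \<and> w e l x < 0 \<and> (\<forall>z. z \<bullet> e \<le> l \<longrightarrow> w e l x \<le> w e l z)"

text \<open>The threshold for \<open>a\<close> is the point at which the derivative
  \<open>p * t powr (p - 1) - 1\<close> of the nonlinearity \<open>t powr p - t\<close>
  vanishes.\<close>

lemma small_at_infinity: "\<exists>R. \<forall>x. R \<le> norm x \<longrightarrow> p * u x powr (p - 1) < 1"
proof -
  have "eventually (\<lambda>x. u x < (1 / p) powr (1 / (p - 1))) at_infinity"
    using limit small by (rule order_tendstoD)
  then obtain R where R: "\<And>x. R \<le> norm x \<Longrightarrow> u x < (1 / p) powr (1 / (p - 1))"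
    by (auto simp: eventually_at_infinity)
  have "p * u x powr (p - 1) < 1" if "R \<le> norm x" for x
  proof -
    have "u x powr (p - 1) < ((1 / p) powr (1 / (p - 1))) powr (p - 1)"
      using R[OF that] pos[of x] p by (intro powr_less_mono2) (auto intro: less_imp_le)
    also have "\<dots> = 1 / p" using p by (simp add: powr_powr)
    finally show ?thesis using p by (simp add: field_simps)
  qed
  then show ?thesis by blast
qed

text \<open>Subtracting the equations at the two points; \<open>C * (l1 - l0)\<close> is the
  fractional Laplacian of \<open>w\<close> at \<open>x\<close>.\<close>

lemma equation_difference:
  obtains l1 l0 where "(truncated_integral s u (reflection e l x) \<longlongrightarrow> l1) (at_right 0)"
    "(truncated_integral s u x \<longlongrightarrow> l0) (at_right 0)"
    "C * (l1 - l0) = u (reflection e l x) powr p - u x powr p - w e l x"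
proof -
  obtain l1 l0 where *: "(truncated_integral s u (reflection e l x) \<longlongrightarrow> l1) (at_right 0)"
    "C * l1 + u (reflection e l x) = u (reflection e l x) powr p"
    "(truncated_integral s u x \<longlongrightarrow> l0) (at_right 0)" "C * l0 + u x = u x powr p"
    using equation by meson
  show ?thesis by (rule that[OF *(1,3)]) (use *(2,4) in \<open>simp add: w_def algebra_simps\<close>)
qed

text \<open>The folded integral is tested on one ball of radius \<open>d / 4\<close>, where the term
  \<open>- 2 * w e l x\<close> times the mirrored kernel already gives a gain proportional to
  \<open>- w e l x\<close>. The equation bounds the same quantity from the other side, and the
  positive factor \<open>- w e l x\<close> cancels.\<close>

lemma negative_min_bound:
  assumes e: "norm e = 1" and min: "negative_min e l x"
  defines "d \<equiv> l - x \<bullet> e"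
  shows "2 * C * (3 * d) powr - s * (unit_ball_vol (real DIM('a)) * (d / 4) ^ DIM('a))
    \<le> p * u x powr (p - 1) - 1"
proof -
  let ?R = "reflection e l" and ?V = "unit_ball_vol (real DIM('a)) * (d / 4) ^ DIM('a)"
  obtain l1 l0 where lim: "(truncated_integral s u (?R x) \<longlongrightarrow> l1) (at_right 0)"
    "(truncated_integral s u x \<longlongrightarrow> l0) (at_right 0)"
    and diff: "C * (l1 - l0) = u (?R x) powr p - u x powr p - w e l x"
    by (rule equation_difference)
  have x: "x \<bullet> e < l" "w e l x < 0" and minz: "\<And>z. z \<bullet> e \<le> l \<Longrightarrow> w e l x \<le> w e l z"
    using min by (auto simp: negative_min_def)
  have d: "0 < d" using x by (simp add: d_def)
  have s0: "0 < s" using s by (rule le_less_trans[rotated]) simp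
  \<comment> \<open>The centre is moved away from the hyperplane by \<open>d / 2\<close>, so the
    ball stays in the half space and does not reach \<open>x\<close>. Mirror images of its points
    are within \<open>2 * d + d / 2 + d / 4 < 3 * d\<close> of \<open>x\<close>.\<close>
  define c where "c = x - (d / 2) *\<^sub>R e"
  have cx: "dist c x = d / 2" using e d by (simp add: c_def dist_norm)
  have ce: "c \<bullet> e = x \<bullet> e - d / 2" using e by (simp add: c_def inner_diff_left norm_eq_1)
  have below: "z \<bullet> e < l" if "z \<in> ball c (d / 4)" for z
  proof -
    have "z \<bullet> e - (x \<bullet> e - d / 2) \<le> dist c z" using inner_diff_le_dist[OF e, of z c] by (simp only: ce)
    moreover have "dist c z < d / 4" using that by simp
    ultimately have "z \<bullet> e < x \<bullet> e + d" using d by linarith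
    then show ?thesis by (simp add: d_def)
  qed
  have "l1 - l0 \<le> - (- 2 * w e l x * (3 * d) powr - s) * measure lborel (ball c (d / 4))"
  proof (rule reflected_difference_bound[where w = "w e l", OF e measurable_u bdd s _ lim x(1) _ minz below])
    fix z assume z: "z \<in> ball c (d / 4)"
    have "dist x (?R z) \<le> dist x (?R x) + dist (?R x) (?R z)" by (rule dist_triangle)
    also have "dist x (?R x) = 2 * d"
      using e x by (simp add: dist_norm reflection_def d_def)
    also have "dist (?R x) (?R z) \<le> dist x c + dist c z"
      by (simp add: dist_reflection[OF e] dist_triangle)
    finally have "dist x (?R z) \<le> 2 * d + (d / 2 + dist c z)" using cx by (simp add: dist_commute)
    moreover have "dist c z < d / 4" using z by simp
    ultimately have "dist x (?R z) \<le> 3 * d" using d by linarith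
    moreover have "dist c x \<le> dist c z + dist x z" by (rule dist_triangle2)
    then have xz: "0 < dist x z" using z cx d unfolding mem_ball by linarith
    then have "0 < dist x (?R z)"
      using dist_less_dist_reflection[OF e x(1) below[OF z]] by (rule less_trans)
    ultimately have K: "(3 * d) powr - s \<le> dist x (?R z) powr - s"
      using s0 by (intro powr_mono2') auto
    have K': "dist x (?R z) powr - s \<le> dist x z powr - s"
      using s0 xz dist_less_dist_reflection[OF e x(1) below[OF z]] by (intro powr_mono2') auto
    have "0 \<le> (w e l z - w e l x) * (dist x z powr - s - dist x (?R z) powr - s)"
      using K' minz[of z] below[OF z] by (intro mult_nonneg_nonneg) auto
    moreover have "(- 2 * w e l x) * (3 * d) powr - s \<le> (- 2 * w e l x) * dist x (?R z) powr - s"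
      using K x by (intro mult_left_mono) auto
    ultimately show "- 2 * w e l x * (3 * d) powr - s
        \<le> (w e l z - w e l x) * (dist x z powr - s - dist x (?R z) powr - s)
          - 2 * w e l x * dist x (?R z) powr - s"
      by simp
  qed (use x d cx in \<open>auto simp: w_def mult_nonpos_nonneg\<close>)
  also have "measure lborel (ball c (d / 4)) = ?V"
    using d by (simp add: content_ball)
  finally have upper: "l1 - l0 \<le> w e l x * (2 * (3 * d) powr - s * ?V)"
    by (simp add: mult_ac)
  have "u x powr p - u (?R x) powr p \<le> p * u x powr (p - 1) * (u x - u (?R x))"
    using p pos x by (intro powr_diff_le) (auto simp: w_def)
  then have "(- w e l x) * (1 - p * u x powr (p - 1)) \<le> C * (l1 - l0)"
    unfolding diff by (simp add: w_def algebra_simps)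
  also have "\<dots> \<le> C * (w e l x * (2 * (3 * d) powr - s * ?V))"
    using upper C by (intro mult_left_mono) auto
  finally have "(- w e l x) * (2 * C * (3 * d) powr - s * ?V) \<le> (- w e l x) * (p * u x powr (p - 1) - 1)"
    by (simp add: algebra_simps)
  then show ?thesis
    by (rule mult_left_le_imp_le) (use x in simp)
qed

text \<open>The left side of the preceding bound is a positive constant times
  \<open>d powr (DIM('a) - s)\<close>. Its positivity forces
  \<open>p * u x powr (p - 1) > 1\<close>, which fails far out; its blow-up as \<open>d\<close>
  tends to 0 contradicts the boundedness of \<open>u\<close>. Neither constant depends on
  \<open>e\<close> or \<open>l\<close>.\<close>

lemma negative_min_confined:
  "\<exists>R \<delta>. 0 < \<delta> \<and> (\<forall>e l x. norm e = 1 \<longrightarrow> negative_min e l x \<longrightarrow> norm x < R \<and> \<delta> \<le> l - x \<bullet> e)"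
proof -
  obtain R where R: "\<And>x. R \<le> norm x \<Longrightarrow> p * u x powr (p - 1) < 1"
    using small_at_infinity by blast
  let ?D = "real DIM('a)"
  define \<kappa> where "\<kappa> = 2 * C * 3 powr - s * unit_ball_vol ?D * (1 / 4) ^ DIM('a)"
  define Q where "Q = p * M powr (p - 1)"
  have M: "0 < M" using bdd[of 0] pos[of 0] by linarith
  have pos': "0 < \<kappa>" "0 < Q" using C p M by (simp_all add: \<kappa>_def Q_def)
  \<comment> \<open>The distance at which \<open>\<kappa> * d powr (DIM('a) - s)\<close> equals the
    upper bound \<open>Q\<close>.\<close>
  define \<delta> where "\<delta> = (\<kappa> / Q) powr (1 / (s - ?D))"
  have "norm x < R \<and> \<delta> \<le> l - x \<bullet> e" if e: "norm e = 1" and min: "negative_min e l x" for e l x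
  proof -
    define d where "d = l - x \<bullet> e"
    have d: "0 < d" using min by (simp add: d_def negative_min_def)
    have "2 * C * (3 * d) powr - s * (unit_ball_vol ?D * (d / 4) ^ DIM('a)) = \<kappa> * d powr (?D - s)"
      using d by (simp add: \<kappa>_def powr_mult powr_diff powr_minus_divide powr_realpow power_divide mult_ac)
    with negative_min_bound[OF e min] have bound: "\<kappa> * d powr (?D - s) \<le> p * u x powr (p - 1) - 1"
      by (simp add: d_def)
    moreover have "0 < \<kappa> * d powr (?D - s)" using pos' d by simp
    ultimately have "1 < p * u x powr (p - 1)" by linarith
    then have 1: "norm x < R" using R[of x] by fastforce
    have "u x powr (p - 1) \<le> M powr (p - 1)"
      using p pos[of x] bdd[of x] by (intro powr_mono2) auto
    then have "p * u x powr (p - 1) \<le> Q" using p by (simp add: Q_def)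
    with bound have "\<kappa> * d powr (?D - s) \<le> Q" by linarith
    then have "\<kappa> / Q \<le> d powr (s - ?D)"
      using pos' d by (simp add: powr_diff field_simps)
    then have "\<delta> \<le> (d powr (s - ?D)) powr (1 / (s - ?D))"
      unfolding \<delta>_def using pos' s by (intro powr_mono2) auto
    also have "\<dots> = d" using d s by (simp add: powr_powr)
    finally show ?thesis using 1 by (simp add: d_def)
  qed
  moreover have "0 < \<delta>" using pos' by (simp add: \<delta>_def)
  ultimately show ?thesis by blast
qed

text \<open>A zero of \<open>w\<close> in the open half space is a minimum. If \<open>w\<close> were
  positive at some \<open>y\<close> there, a small ball around \<open>y\<close> would make
  \<open>l1 - l0\<close> negative, while the equations at \<open>x\<close> and its mirror image,
  where \<open>u\<close> has equal values, give \<open>l1 = l0\<close>.\<close>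

lemma strong_maximum_principle:
  assumes e: "norm e = 1" and adm: "admissible e l" and x: "x \<bullet> e < l" "w e l x = 0"
  shows "w e l z = 0"
proof -
  let ?R = "reflection e l"
  have s0: "0 < s" using s by (rule le_less_trans[rotated]) simp
  have zero: "w e l y = 0" if y: "y \<bullet> e < l" for y
  proof (rule ccontr)
    assume "w e l y \<noteq> 0"
    moreover have "0 \<le> w e l y" using adm y by (simp add: admissible_def)
    ultimately have wy: "0 < w e l y" by simp
    have "y \<noteq> x" using wy x by auto
    \<comment> \<open>The folded integrand at \<open>x\<close> when \<open>w e l x = 0\<close>. It
      is continuous at \<open>y\<close>, hence above half its value on a ball around
      \<open>y\<close>.\<close>
    define \<Phi> where "\<Phi> z = w e l z * (dist x z powr - s - dist x (?R z) powr - s)" for z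
    have far: "dist x y < dist x (?R y)" by (rule dist_less_dist_reflection[OF e x(1) y])
    have "0 < \<Phi> y"
      using wy far \<open>y \<noteq> x\<close> s0 by (simp add: \<Phi>_def powr_less_mono2_neg)
    define \<eta> where "\<eta> = \<Phi> y / 2"
    have \<eta>: "0 < \<eta>" "\<eta> < \<Phi> y" using \<open>0 < \<Phi> y\<close> by (simp_all add: \<eta>_def)
    have "isCont (w e l) y" "isCont ?R y"
      by (auto intro!: continuous_on_interior[of UNIV] continuous_intros)
    then have "isCont \<Phi> y"
      unfolding \<Phi>_def using \<open>y \<noteq> x\<close> far by (intro continuous_intros) auto
    then have "eventually (\<lambda>z. \<eta> < \<Phi> z) (nhds y)"
      using \<eta>(2) by (auto simp: isCont_def tendsto_at_iff_tendsto_nhds intro: order_tendstoD)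
    moreover have "eventually (\<lambda>z. z \<bullet> e < l) (nhds y)"
      using y by (intro order_tendstoD(2)[of "\<lambda>z. z \<bullet> e" "y \<bullet> e"] tendsto_intros filterlim_ident)
    ultimately have "eventually (\<lambda>z. \<eta> < \<Phi> z \<and> z \<bullet> e < l) (nhds y)"
      by (rule eventually_conj)
    then obtain r0 where r0: "0 < r0" "\<And>z. dist z y < r0 \<Longrightarrow> \<eta> < \<Phi> z \<and> z \<bullet> e < l"
      by (auto simp: eventually_nhds_metric)
    define r where "r = min r0 (dist y x / 2)"
    have r: "0 < r" "r < dist y x" "\<And>z. z \<in> ball y r \<Longrightarrow> \<eta> < \<Phi> z \<and> z \<bullet> e < l"
      using r0 \<open>y \<noteq> x\<close> by (auto simp: r_def dist_commute min_less_iff_disj)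
    obtain l1 l0 where lim: "(truncated_integral s u (?R x) \<longlongrightarrow> l1) (at_right 0)"
      "(truncated_integral s u x \<longlongrightarrow> l0) (at_right 0)"
      and diff: "C * (l1 - l0) = u (?R x) powr p - u x powr p - w e l x"
      by (rule equation_difference)
    have "l1 - l0 \<le> - \<eta> * measure lborel (ball y r)"
    proof (rule reflected_difference_bound[where w = "w e l", OF e measurable_u bdd s _ lim x(1)])
      fix z assume "z \<in> ball y r"
      then show "\<eta> \<le> (w e l z - w e l x) * (dist x z powr - s - dist x (?R z) powr - s)
          - 2 * w e l x * dist x (?R z) powr - s"
        using r(3)[of z] x by (simp add: \<Phi>_def)
    qed (use x r \<eta> adm in \<open>auto simp: admissible_def w_def\<close>)
    moreover have "0 < measure lborel (ball y r)"
      using r by (simp add: content_ball)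
    ultimately have "l1 - l0 < 0" using \<eta>(1) by (smt (verit) mult_pos_pos mult_minus_left)
    moreover have "C * (l1 - l0) = 0" using diff x by (simp add: w_def)
    ultimately show False using C by simp
  qed
  consider "z \<bullet> e < l" | "z \<bullet> e = l" | "?R z \<bullet> e < l"
    using inner_reflection[OF e, of l z] by linarith
  then show ?thesis
    using zero zero[of "?R z"] w_hyperplane w_reflection[OF e, of l z] by cases auto
qed

section \<open>Motion of the plane\<close>

text \<open>At infinity \<open>u\<close> tends to \<open>a\<close> both at a point and at its mirror
  image, so \<open>w\<close> tends to 0 and a negative infimum is attained. It is attained off the
  hyperplane because \<open>w\<close> vanishes there.\<close>

lemma negative_min_exists:
  assumes e: "norm e = 1" and "\<not> admissible e l"
  shows "\<exists>x. negative_min e l x"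
proof -
  let ?R = "reflection e l"
  obtain y where y: "y \<bullet> e \<le> l" "w e l y < 0"
    using assms(2) by (auto simp: admissible_def not_le)
  obtain b where b: "\<And>x. b \<le> norm x \<Longrightarrow> dist (u x) a < - w e l y / 2"
    using limit[unfolded Lim_at_infinity, rule_format, of "- w e l y / 2"] y by auto
  \<comment> \<open>Beyond this radius both \<open>z\<close> and its mirror image have norm at least
    \<open>b\<close>; the second entry of the maximum puts \<open>y\<close> into the compact
    set.\<close>
  define \<rho> where "\<rho> = max (\<bar>b\<bar> + norm (?R 0)) (norm y)"
  have out: "w e l y < w e l z" if "\<rho> < norm z" for z
  proof -
    have "norm z \<le> norm (?R z) + norm (?R 0)"
      using dist_reflection[OF e, of l z 0] norm_triangle_ineq4[of "?R z" "?R 0"] by (simp add: dist_norm)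
    moreover have "\<bar>b\<bar> + norm (?R 0) < norm z" using that by (simp add: \<rho>_def)
    ultimately have "b \<le> norm z" "b \<le> norm (?R z)"
      using norm_ge_zero[of "?R 0"] by linarith+
    then show ?thesis
      using b[of z] b[of "?R z"] unfolding w_def[of e l z] dist_real_def by linarith
  qed
  let ?K = "cball 0 \<rho> \<inter> {z. z \<bullet> e \<le> l}"
  have "compact ?K"
    by (intro compact_Int_closed closed_Collect_le continuous_intros) auto
  moreover have "y \<in> ?K" using y by (simp add: \<rho>_def)
  moreover have "continuous_on ?K (w e l)" by (intro continuous_intros)
  ultimately obtain x where x: "x \<in> ?K" "\<And>z. z \<in> ?K \<Longrightarrow> w e l x \<le> w e l z"
    using continuous_attains_inf[of ?K "w e l"] by blast
  have xy: "w e l x \<le> w e l y" using x(2) \<open>y \<in> ?K\<close> by blast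
  have "w e l x \<le> w e l z" if "z \<bullet> e \<le> l" for z
    using x(2)[of z] out[of z] that xy by (cases "norm z \<le> \<rho>") auto
  moreover have "x \<bullet> e \<noteq> l" using xy y w_hyperplane[of x e l] by auto
  ultimately show ?thesis
    using x(1) le_less_trans[OF xy y(2)] by (intro exI[of _ x]) (auto simp: negative_min_def)
qed

text \<open>For such \<open>l\<close> the half space misses the ball of radius \<open>R\<close> that
  contains every negative minimum.\<close>

lemma admissible_far: "\<exists>R. \<forall>e l. norm e = 1 \<longrightarrow> l \<le> - R \<longrightarrow> admissible e l"
proof -
  obtain R where R: "\<And>e l x. norm e = 1 \<Longrightarrow> negative_min e l x \<Longrightarrow> norm x < R"
    using negative_min_confined by blast
  have "admissible e l" if e: "norm e = 1" and l: "l \<le> - R" for e l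
  proof (rule ccontr)
    assume "\<not> admissible e l"
    then obtain x where x: "negative_min e l x" using negative_min_exists[OF e] by blast
    have "\<bar>x \<bullet> e\<bar> \<le> norm x" using Cauchy_Schwarz_ineq2[of x e] e by simp
    then show False using R[OF e x] l x by (auto simp: negative_min_def)
  qed
  then show ?thesis by blast
qed

text \<open>For fixed \<open>z\<close> below the hyperplane, \<open>w e m z\<close> is continuous in
  \<open>m\<close>, and \<open>z\<close> still lies below the planes with \<open>m\<close> slightly
  smaller than \<open>l\<close>.\<close>

lemma admissible_left_limit:
  assumes "\<And>m. m < l \<Longrightarrow> admissible e m"
  shows "admissible e l"
  unfolding admissible_def
proof (intro allI impI)
  fix z assume z: "z \<bullet> e \<le> l"
  show "0 \<le> w e l z"
  proof (cases "z \<bullet> e = l")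
    case False
    have "continuous_on UNIV (\<lambda>m. w e m z)" by (intro continuous_intros)
    then have "((\<lambda>m. w e m z) \<longlongrightarrow> w e l z) (at_left l)"
      by (auto simp: continuous_on_def intro: tendsto_within_subset)
    moreover have "eventually (\<lambda>m. 0 \<le> w e m z) (at_left l)"
    proof -
      have "eventually (\<lambda>m. m \<in> {z \<bullet> e<..<l}) (at_left l)"
        using z False by (intro eventually_at_left_real) auto
      then show ?thesis
        by eventually_elim (use assms in \<open>auto simp: admissible_def\<close>)
    qed
    ultimately show ?thesis
      by (rule tendsto_lowerbound) simp
  qed (simp add: w_hyperplane)
qed

text \<open>Otherwise planes decreasing to \<open>l\<close> carry negative minima, which stay in a
  fixed ball and accumulate at some \<open>q\<close> with \<open>w e l q = 0\<close>. The strong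
  maximum principle then makes \<open>w\<close> vanish identically.\<close>

lemma admissible_right_open:
  assumes e: "norm e = 1" and adm: "admissible e l" and "w e l y \<noteq> 0"
  shows "\<exists>\<epsilon>>0. \<forall>m. l < m \<longrightarrow> m < l + \<epsilon> \<longrightarrow> admissible e m"
proof (rule ccontr)
  assume neg: "\<not> ?thesis"
  obtain R \<delta> where R: "\<And>m x. negative_min e m x \<Longrightarrow> norm x < R"
    and \<delta>: "0 < \<delta>" "\<And>m x. negative_min e m x \<Longrightarrow> \<delta> \<le> m - x \<bullet> e"
    using negative_min_confined e by blast
  have "\<exists>m x. l < m \<and> m < l + 1 / Suc k \<and> negative_min e m x" for k
    using neg negative_min_exists[OF e] by (metis of_nat_0_less_iff zero_less_Suc zero_less_divide_1_iff)
  then obtain m x where mx: "\<And>k. l < m k" "\<And>k. m k < l + 1 / Suc k" "\<And>k. negative_min e (m k) (x k)"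
    by metis
  have m: "m \<longlonglongrightarrow> l"
  proof (rule tendsto_sandwich[of "\<lambda>_. l" m _ "\<lambda>k. l + 1 / Suc k"])
    show "(\<lambda>k. l + 1 / Suc k) \<longlonglongrightarrow> l"
      using tendsto_add[OF tendsto_const LIMSEQ_inverse_real_of_nat] by (simp add: inverse_eq_divide)
  qed (use mx in \<open>auto intro!: always_eventually less_imp_le\<close>)
  have "\<forall>k. x k \<in> cball 0 R" using R[OF mx(3)] by (auto intro: less_imp_le)
  then obtain q \<sigma> where q: "strict_mono \<sigma>" "(x \<circ> \<sigma>) \<longlonglongrightarrow> q"
    using compact_cball[unfolded compact_def] by metis
  have m\<sigma>: "(\<lambda>k. m (\<sigma> k)) \<longlonglongrightarrow> l"
    using LIMSEQ_subseq_LIMSEQ[OF m q(1)] by (simp add: o_def)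
  have x\<sigma>: "(\<lambda>k. x (\<sigma> k)) \<longlonglongrightarrow> q" using q(2) by (simp add: o_def)
  \<comment> \<open>The uniform distance keeps \<open>q\<close> off the hyperplane, where a zero of
    \<open>w\<close> would carry no information.\<close>
  have "\<delta> \<le> l - q \<bullet> e"
    by (rule tendsto_lowerbound[of "\<lambda>k. m (\<sigma> k) - x (\<sigma> k) \<bullet> e"])
      (use \<delta>(2)[OF mx(3)] in \<open>auto intro!: tendsto_intros m\<sigma> x\<sigma>\<close>)
  then have qe: "q \<bullet> e < l" using \<delta>(1) by linarith
  have "(\<lambda>k. w e (m (\<sigma> k)) (x (\<sigma> k))) \<longlonglongrightarrow> w e l q"
  proof -
    have "continuous_on UNIV (\<lambda>t. w e (fst t) (snd t))" by (intro continuous_intros)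
    from continuous_on_tendsto_compose[OF this tendsto_Pair[OF m\<sigma> x\<sigma>]] show ?thesis by simp
  qed
  moreover have "w e (m (\<sigma> k)) (x (\<sigma> k)) \<le> 0" for k
    using mx(3)[of "\<sigma> k"] by (simp add: negative_min_def)
  ultimately have "w e l q \<le> 0"
    by (intro tendsto_upperbound[of _ "w e l q" sequentially]) auto
  moreover have "0 \<le> w e l q" using adm qe by (simp add: admissible_def)
  ultimately have "w e l y = 0" using strong_maximum_principle[OF e adm qe] by simp
  with assms(3) show False by simp
qed

text \<open>The plane stops at the supremum of the positions reached, and by left limits and right
  openness it can stop only where \<open>w\<close> vanishes. Admissibility of all earlier positions
  is recorded for the monotonicity.\<close>

lemma symmetric_hyperplane:
  assumes e: "norm e = 1"
  shows "\<exists>l. (\<forall>m\<le>l. admissible e m) \<and> (\<forall>z. w e l z = 0)"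
proof (rule ccontr)
  assume neg: "\<not> ?thesis"
  define P where "P = {l. \<forall>m\<le>l. admissible e m}"
  obtain R where R: "\<And>e l. norm e = 1 \<Longrightarrow> l \<le> - R \<Longrightarrow> admissible e l"
    using admissible_far by blast
  have "- R \<in> P" using R[OF e] by (simp add: P_def)
  show False
  proof (cases "bdd_above P")
    case True
    define l where "l = Sup P"
    have adm: "admissible e m" if lt: "m < l" for m
    proof -
      obtain t where "t \<in> P" "m < t"
        using lt \<open>- R \<in> P\<close> True less_cSup_iff[of P m] unfolding l_def by blast
      then show ?thesis by (simp add: P_def)
    qed
    then have "admissible e l" by (rule admissible_left_limit)
    with adm have "l \<in> P" by (auto simp: P_def le_less)
    then obtain y where "w e l y \<noteq> 0" using neg by (auto simp: P_def)
    then obtain \<epsilon> where \<epsilon>: "0 < \<epsilon>" "\<And>m. l < m \<Longrightarrow> m < l + \<epsilon> \<Longrightarrow> admissible e m"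
      using admissible_right_open[OF e \<open>admissible e l\<close>] by blast
    have "l + \<epsilon> / 2 \<in> P"
      unfolding P_def using \<epsilon> adm \<open>admissible e l\<close> by (smt (verit) field_sum_of_halves mem_Collect_eq)
    then have "l + \<epsilon> / 2 \<le> l" unfolding l_def using True by (rule cSup_upper)
    then show False using \<epsilon>(1) by simp
  next
    case False
    \<comment> \<open>If the plane never stops, it passes the level \<open>R\<close>, which the
      plane coming from the opposite direction also reaches. The same hyperplane is then described
      by \<open>- e\<close> and \<open>- R\<close>, so \<open>w\<close> is nonnegative on both
      sides, and antisymmetry makes it zero.\<close>
    then obtain t where t: "t \<in> P" "R < t" by (auto simp: bdd_above_def not_le)
    then have adm: "\<forall>m\<le>R. admissible e m" by (auto simp: P_def)
    have "admissible (- e) (- R)" using R[of "- e"] e by simp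
    moreover have "reflection (- e) (- R) z = reflection e R z" for z
      by (simp add: reflection_def algebra_simps)
    ultimately have right: "0 \<le> w e R z" if "R \<le> z \<bullet> e" for z
      using that by (auto simp: admissible_def w_def)
    have left: "0 \<le> w e R z" if "z \<bullet> e \<le> R" for z
      using adm that by (auto simp: admissible_def)
    have "0 \<le> w e R z" for z using left right linear by blast
    then have "w e R z = 0" for z
      using w_reflection[OF e, of R z] by (metis neg_0_le_iff_le order_antisym)
    with adm neg show False by blast
  qed
qed

section \<open>From symmetry hyperplanes to radial symmetry\<close>

text \<open>The two points are mirror images in the hyperplane through their midpoint, whose level
  \<open>m\<close> is at most \<open>l\<close>.\<close>

lemma monotone_up_to_hyperplane:
  assumes e: "norm e = 1" and adm: "\<forall>m\<le>l. admissible e m" and "t \<le> t'" "x \<bullet> e + t' \<le> l"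
  shows "u (x + t *\<^sub>R e) \<le> u (x + t' *\<^sub>R e)"
proof -
  define m where "m = x \<bullet> e + (t + t') / 2"
  have ee: "(x + t *\<^sub>R e) \<bullet> e = x \<bullet> e + t" using e by (simp add: inner_add_left norm_eq_1)
  have "m \<le> l" using assms by (simp add: m_def field_simps)
  then have "0 \<le> w e m (x + t *\<^sub>R e)"
    using adm assms(3) by (auto simp: admissible_def m_def ee)
  moreover have "reflection e m (x + t *\<^sub>R e) = x + t' *\<^sub>R e"
  proof -
    have "2 * (x \<bullet> e + t - m) = t - t'" by (simp add: m_def field_simps)
    then have "reflection e m (x + t *\<^sub>R e) = (x + t *\<^sub>R e) - (t - t') *\<^sub>R e"
      by (simp only: reflection_def ee)
    then show ?thesis by (simp add: algebra_simps)
  qed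
  ultimately show ?thesis by (simp add: w_def)
qed

text \<open>Along the multiples of \<open>v\<close> the argument tends to infinity while the value
  stays \<open>u z\<close>, so this value is the limit \<open>a\<close>.\<close>

lemma periodic_imp_constant:
  assumes per: "\<And>z. u (z + v) = u z" and "v \<noteq> 0"
  shows "u z = a"
proof -
  have per': "u (z + real k *\<^sub>R v) = u z" for k
  proof (induction k)
    case (Suc k)
    then show ?case using per[of "z + real k *\<^sub>R v"] by (simp add: algebra_simps)
  qed simp
  have "filterlim (\<lambda>k. real k * norm v) at_top sequentially"
    by (rule filterlim_at_top_mult_tendsto_pos[OF tendsto_const _ filterlim_real_sequentially])
      (use \<open>v \<noteq> 0\<close> in simp)
  then have "filterlim (\<lambda>k. real k *\<^sub>R v) at_infinity sequentially"
    by (simp add: filterlim_at_infinity_conv_norm_at_top)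
  then have "filterlim (\<lambda>k. z + real k *\<^sub>R v) at_infinity sequentially"
    by (rule tendsto_add_filterlim_at_infinity[OF tendsto_const])
  from filterlim_compose[OF limit this] have "(\<lambda>k. u z) \<longlonglongrightarrow> a"
    by (simp add: per')
  then show ?thesis by (simp add: LIMSEQ_const_iff)
qed

lemma radially_decreasing: "\<exists>x\<^sub>0 \<phi>. antimono_on {0..} \<phi> \<and> (\<forall>x. u x = \<phi> (norm (x - x\<^sub>0)))"
proof -
  obtain h where h: "\<And>e m. norm e = 1 \<Longrightarrow> m \<le> h e \<Longrightarrow> admissible e m"
      and sym: "\<And>e z. norm e = 1 \<Longrightarrow> u (reflection e (h e) z) = u z"
    using symmetric_hyperplane unfolding w_def by (metis eq_iff_diff_eq_0)
  define x\<^sub>0 where "x\<^sub>0 = (\<Sum>b\<in>Basis. h b *\<^sub>R b)"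
  \<comment> \<open>Reflection along one basis vector leaves the other coordinates unchanged, so
    composing over the whole basis yields the point reflection in \<open>x\<^sub>0\<close>.\<close>
  have flip: "u (x - (\<Sum>b\<in>J. (2 * (x \<bullet> b - h b)) *\<^sub>R b)) = u x" if "finite J" "J \<subseteq> Basis" for x and J :: "'a set"
    using that
  proof (induction J)
    case (insert b J)
    let ?y = "x - (\<Sum>b\<in>J. (2 * (x \<bullet> b - h b)) *\<^sub>R b)"
    have b: "norm b = 1" using insert by simp
    have "(\<Sum>c\<in>J. (2 * (x \<bullet> c - h c)) *\<^sub>R c) \<bullet> b = 0"
      using insert by (auto simp: inner_sum_left inner_Basis intro!: sum.neutral)
    then have "?y \<bullet> b = x \<bullet> b" by (simp add: inner_diff_left)
    then have "reflection b (h b) ?y = x - (\<Sum>b\<in>insert b J. (2 * (x \<bullet> b - h b)) *\<^sub>R b)"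
      using insert by (simp add: reflection_def)
    then show ?case
      using sym[OF b, of ?y] insert by simp
  qed simp
  have central: "u (2 *\<^sub>R x\<^sub>0 - x) = u x" for x
  proof -
    have "(\<Sum>b\<in>Basis. (2 * (x \<bullet> b - h b)) *\<^sub>R b) = 2 *\<^sub>R (\<Sum>b\<in>Basis. (x \<bullet> b) *\<^sub>R b) - 2 *\<^sub>R x\<^sub>0"
      by (simp add: x\<^sub>0_def scaleR_sum_right sum_subtractf algebra_simps)
    then have "(\<Sum>b\<in>Basis. (2 * (x \<bullet> b - h b)) *\<^sub>R b) = 2 *\<^sub>R x - 2 *\<^sub>R x\<^sub>0"
      by (simp only: euclidean_representation)
    then have "u (x - (2 *\<^sub>R x - 2 *\<^sub>R x\<^sub>0)) = u x"
      using flip[of Basis x] by simp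
    then show ?thesis by (simp add: scaleR_2 algebra_simps)
  qed
  show ?thesis
  proof (cases "\<exists>e. norm e = 1 \<and> h e \<noteq> x\<^sub>0 \<bullet> e")
    case True
    then obtain e where e: "norm e = 1" "h e \<noteq> x\<^sub>0 \<bullet> e" by blast
    \<comment> \<open>The reflection followed by the point reflection, performed twice, is the
      translation by this vector.\<close>
    let ?v = "(4 * (x\<^sub>0 \<bullet> e - h e)) *\<^sub>R e"
    have "u (z + ?v) = u z" for z
    proof -
      let ?y = "2 *\<^sub>R x\<^sub>0 - reflection e (h e) z"
      have ye: "?y \<bullet> e = 2 * (x\<^sub>0 \<bullet> e) - 2 * h e + z \<bullet> e"
        using inner_reflection[OF e(1), of "h e" z] by (simp add: inner_diff_left)
      have "2 *\<^sub>R x\<^sub>0 - reflection e (h e) ?y = z + ?v"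
        by (subst reflection_def) (simp only: ye, simp add: reflection_def algebra_simps, simp flip: scaleR_add_left)
      then show ?thesis
        using central sym[OF e(1)] by metis
    qed
    moreover have "?v \<noteq> 0" using e by auto
    ultimately have "u z = a" for z by (rule periodic_imp_constant)
    then show ?thesis
      by (intro exI[of _ 0] exI[of _ "\<lambda>_. a"]) (auto simp: monotone_on_def)
  next
    case False
    then have he: "h e = x\<^sub>0 \<bullet> e" if "norm e = 1" for e using that by blast
    obtain b :: 'a where "b \<in> Basis" using nonempty_Basis by blast
    then have b: "norm b = 1" by simp
    \<comment> \<open>The ray runs in direction \<open>- b\<close> because monotonicity is known on
      the side \<open>x \<bullet> b \<le> h b\<close> of the hyperplane, which passes through
      \<open>x\<^sub>0\<close>.\<close>
    define \<phi> where "\<phi> r = u (x\<^sub>0 + (- r) *\<^sub>R b)" for r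
    have "antimono_on {0..} \<phi>"
    proof (rule monotone_onI)
      fix r t :: real assume "r \<in> {0..}" "t \<in> {0..}" "r \<le> t"
      then show "\<phi> t \<le> \<phi> r"
        unfolding \<phi>_def using h[OF b] by (intro monotone_up_to_hyperplane[OF b, of "h b"]) (auto simp: he[OF b])
    qed
    moreover have "u x = \<phi> (norm (x - x\<^sub>0))" for x
    proof -
      define y where "y = x\<^sub>0 + (- norm (x - x\<^sub>0)) *\<^sub>R b"
      have \<phi>y: "\<phi> (norm (x - x\<^sub>0)) = u y" by (simp only: \<phi>_def y_def)
      show ?thesis
      proof (cases "x = y")
        case False
        \<comment> \<open>For \<open>x\<close> and \<open>y\<close> equally far from
          \<open>x\<^sub>0\<close>, the hyperplane through \<open>x\<^sub>0\<close> orthogonal to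
          \<open>x - y\<close> is their perpendicular bisector, so its reflection exchanges
          them.\<close>
        define e where "e = (1 / norm (x - y)) *\<^sub>R (x - y)"
        have e: "norm e = 1" using False by (simp add: e_def)
        have "norm (y - x\<^sub>0) = norm (x - x\<^sub>0)" using b by (simp add: y_def)
        then have "(y - x\<^sub>0) \<bullet> (y - x\<^sub>0) = (x - x\<^sub>0) \<bullet> (x - x\<^sub>0)" by (simp only: norm_eq)
        then have half: "2 * ((x - x\<^sub>0) \<bullet> (x - y)) = (norm (x - y))\<^sup>2"
          unfolding power2_norm_eq_inner by (simp add: inner_simps inner_commute algebra_simps)
        have "2 * (x \<bullet> e - x\<^sub>0 \<bullet> e) = (2 * ((x - x\<^sub>0) \<bullet> (x - y))) / norm (x - y)"
          by (simp add: e_def inner_diff_left diff_divide_distrib)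
        also have "\<dots> = norm (x - y)" unfolding half by (simp add: power2_eq_square)
        finally have "reflection e (h e) x = x - norm (x - y) *\<^sub>R e"
          by (simp add: reflection_def he[OF e])
        also have "\<dots> = y" using False by (simp add: e_def)
        finally show ?thesis using sym[OF e, of x] \<phi>y by simp
      qed (use \<phi>y in simp)
    qed
    ultimately show ?thesis by blast
  qed
qed

end

theorem theorem6:
  fixes u :: "real ^ 'n \<Rightarrow> real" and \<alpha> p a C :: real
  assumes "0 < \<alpha>" and "\<alpha> < 2" and "1 < p" and "0 < C"
    and "u \<in> L_space \<alpha> \<inter> C11_loc"
    and "\<And>x. 0 < u x"
    and "\<And>x. frac_laplacian C \<alpha> u x + u x = u x powr p"
    and "(u \<longlongrightarrow> a) at_infinity"
    and "a < (1 / p) powr (1 / (p - 1))"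
  shows "\<exists>(x\<^sub>0 :: real ^ 'n) (\<phi> :: real \<Rightarrow> real).
           antimono_on {0..} \<phi> \<and> (\<forall>x. u x = \<phi> (norm (x - x\<^sub>0)))"
proof -
  obtain g where g: "\<And>x. GDERIV u x :> g x"
    and lip: "\<And>x. \<exists>r>0. \<exists>L. L-lipschitz_on (ball x r) g"
    using assms(5) by (auto simp: C11_loc_def)
  have cont: "continuous_on UNIV u"
    using g by (intro continuous_at_imp_continuous_on ballI)
      (metis has_derivative_continuous gderiv_def)
  obtain M where M: "\<And>x. \<bar>u x\<bar> \<le> M"
    using bounded_if_tendsto_at_infinity[OF cont assms(8)] by blast
  \<comment> \<open>The local Lipschitz bound on the gradient and the boundedness of
    \<open>u\<close> make the principal value converge, so the equation becomes a statement about an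
    actual limit.\<close>
  have eq: "\<exists>l. (truncated_integral (real DIM(real ^ 'n) + \<alpha>) u x \<longlongrightarrow> l) (at_right 0)
      \<and> C * l + u x = u x powr p" for x
  proof -
    obtain r L where "0 < r" "L-lipschitz_on (ball x r) g" using lip by blast
    then obtain l where l: "(truncated_integral (real DIM(real ^ 'n) + \<alpha>) u x \<longlongrightarrow> l) (at_right 0)"
      using truncated_integral_converges[OF g _ _ M assms(1,2)] by blast
    then have "frac_laplacian C \<alpha> u x = C * l"
      using cont by (intro frac_laplacian_eq borel_measurable_continuous_onI) auto
    with l assms(7)[of x] show ?thesis by auto
  qed
  interpret moving_planes u "real DIM(real ^ 'n) + \<alpha>" p a C M
    by unfold_locales (use assms cont M eq in auto)
  show ?thesis by (rule radially_decreasing)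
qed

end
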